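(* Let $c=(c_n)_{n=-\infty}^\infty\subseteq\mathbb{H}$ be a non-trivial positive definite sequence with associated left- and right-orthonormal polynomials $(\psi_n^L)_{n=0}^\infty$ and $(\psi_n^R)_{n=0}^\infty$, and denote their respective reverse polynomials by $(\psi_n^{L,\#})_{n=0}^\infty$ and $(\psi_n^{R,\#})_{n=0}^\infty$. Then for all integers $n\ge0$, $$\mathcal{Z}(\psi_n^L)\subseteq\mathbb{B}\quad\text{and}\quad\mathcal{Z}(\psi_n^R)\subseteq\mathbb{B},$$ and $$\mathcal{Z}(\psi_n^{L,\#})\subseteq\mathbb{H}\setminus\overline{\mathbb{B}}\quad\text{and}\quad\mathcal{Z}(\psi_n^{R,\#})\subseteq\mathbb{H}\setminus\overline{\mathbb{B}}.$$
   Context: $\mathbb{H}$ is the quaternions, $\mathbb{B}=\{p\in\mathbb{H}:|p|<1\}$ the open unit ball and $\overline{\mathbb{B}}$ its closure. The zero set of a polynomial $\varphi$ (with coefficients all on the left or all on the right) is $\mathcal{Z}(\varphi)=\{q\in\mathbb{H}:\varphi(q)=0\}$. A bi-infinite sequence $c=(c_n)_{n\in\mathbb{Z}}$ in $\mathbb{H}$ is positive definite if for every $n\ge0$ the Toeplitz matrix $T_n(c)=[c_{\ell-k}]_{k,\ell=0}^n$ (row $k$, column $\ell$) is positive semidefinite ($\xi^*T_n(c)\xi\ge0$ for all $\xi\in\mathbb{H}^{n+1}$), and is non-trivial if moreover every $T_n(c)$ is positive definite ($\xi^*T_n(c)\xi>0$ for all nonzero $\xi\in\mathbb{H}^{n+1}$).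 Then $c_{-n}=\overline{c_n}$. $\mathbb{H}[p]^L$ is the set of polynomials $\sum_k p^k\varphi_k$ and $\mathbb{H}[p]^R$ the set of polynomials $\sum_k\varphi_kp^k$, with $\varphi_k\in\mathbb{H}$. On $\mathbb{H}[p]^L$ put $\langle\varphi,\psi\rangle_R=\sum_{k,\ell}\overline{\psi_\ell}\,c_{k-\ell}\,\varphi_k$; on $\mathbb{H}[p]^R$ put $\langle\varphi,\psi\rangle_L=\sum_{k,\ell}\varphi_k\,c_{k-\ell}\,\overline{\psi_\ell}$. The right-orthonormal polynomials $(\psi_n^R)_{n\ge0}\subset\mathbb{H}[p]^L$ (coefficients on the right) and the left-orthonormal polynomials $(\psi_n^L)_{n\ge0}\subset\mathbb{H}[p]^R$ (coefficients on the left) are obtained from $1,p,p^2,\dots$ by the Gram–Schmidt algorithm with respect to $\langle\cdot,\cdot\rangle_R$ and $\langle\cdot,\cdot\rangle_L$ respectively; thus $\psi_n^{R},\psi_n^L$ have degree $n$ and positive real leading coefficient. Reverse polynomials: for $\varphi(p)=\sum_{k=0}^np^k\varphi_k\in\mathbb{H}[p]^L$ of degree $n$, $\varphi^\#(p)=\overline{\varphi(1/\overline p)}\,p^n=\sum_k\overline{\varphi_k}\,p^{n-k}\in\mathbb{H}[p]^R$; for $\psi(p)=\sum_{k=0}^n\psi_kp^k\in\mathbb{H}[p]^R$ of degree $n$, $\psi^\#(p)=p^n\,\overline{\psi(1/\overline p)}=\sum_kp^{n-k}\,\overline{\psi_k}\in\mathbb{H}[p]^L$; $\psi_n^{L,\#}=(\psi_n^L)^\#$,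 $\psi_n^{R,\#}=(\psi_n^R)^\#$. *)

theory Defs
  imports "HOL-Analysis.Analysis" "HOL-Computational_Algebra.Polynomial"
begin

section \<open>Quaternions\<close>

codatatype quat = Quat (qRe: real) (qI: real) (qJ: real) (qK: real)

lemma quat_eqI [intro?]:
  "qRe x = qRe y \<Longrightarrow> qI x = qI y \<Longrightarrow> qJ x = qJ y \<Longrightarrow> qK x = qK y \<Longrightarrow> x = y"
  by (rule quat.expand) simp

lemma quat_eq_iff: "x = y \<longleftrightarrow> qRe x = qRe y \<and> qI x = qI y \<and> qJ x = qJ y \<and> qK x = qK y"
  by (auto intro: quat_eqI)

instantiation quat :: ab_group_add
begin

primcorec zero_quat where
  "qRe 0 = 0" | "qI 0 = 0" | "qJ 0 = 0" | "qK 0 = 0"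

primcorec plus_quat where
  "qRe (x + y) = qRe x + qRe y"
| "qI (x + y) = qI x + qI y"
| "qJ (x + y) = qJ x + qJ y"
| "qK (x + y) = qK x + qK y"

primcorec uminus_quat where
  "qRe (- x) = - qRe x" | "qI (- x) = - qI x" | "qJ (- x) = - qJ x" | "qK (- x) = - qK x"

primcorec minus_quat where
  "qRe (x - y) = qRe x - qRe y"
| "qI (x - y) = qI x - qI y"
| "qJ (x - y) = qJ x - qJ y"
| "qK (x - y) = qK x - qK y"

instance
  by standard (simp_all add: quat_eq_iff)

end

instantiation quat :: ring_1
begin

primcorec one_quat where
  "qRe 1 = 1" | "qI 1 = 0" | "qJ 1 = 0" | "qK 1 = 0"

primcorec times_quat where
  "qRe (x * y) = qRe x * qRe y - qI x * qI y - qJ x * qJ y - qK x * qK y"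
| "qI (x * y) = qRe x * qI y + qI x * qRe y + qJ x * qK y - qK x * qJ y"
| "qJ (x * y) = qRe x * qJ y - qI x * qK y + qJ x * qRe y + qK x * qI y"
| "qK (x * y) = qRe x * qK y + qI x * qJ y - qJ x * qI y + qK x * qRe y"

instance
  by standard (simp_all add: quat_eq_iff algebra_simps)

end

instantiation quat :: real_algebra_1
begin

primcorec scaleR_quat where
  "qRe (r *\<^sub>R x) = r * qRe x"
| "qI (r *\<^sub>R x) = r * qI x"
| "qJ (r *\<^sub>R x) = r * qJ x"
| "qK (r *\<^sub>R x) = r * qK x"

instance
  by standard (simp_all add: quat_eq_iff algebra_simps)

end

primcorec qcnj :: "quat \<Rightarrow> quat" where
  "qRe (qcnj x) = qRe x" | "qI (qcnj x) = - qI x" | "qJ (qcnj x) = - qJ x" | "qK (qcnj x) = - qK x"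

instantiation quat :: real_inner
begin

definition inner_quat_def:
  "inner x y = qRe x * qRe y + qI x * qI y + qJ x * qJ y + qK x * qK y"

definition norm_quat_def:
  "norm x = sqrt ((qRe x)\<^sup>2 + (qI x)\<^sup>2 + (qJ x)\<^sup>2 + (qK x)\<^sup>2)"

definition sgn_quat_def: "sgn (x :: quat) = x /\<^sub>R norm x"

definition dist_quat_def: "dist (x :: quat) y = norm (x - y)"

definition uniformity_quat_def [code del]:
  "(uniformity :: (quat \<times> quat) filter) = (INF e\<in>{0 <..}. principal {(x, y). dist x y < e})"

definition open_quat_def [code del]:
  "open (U :: quat set) \<longleftrightarrow> (\<forall>x\<in>U. eventually (\<lambda>(x', y). x' = x \<longrightarrow> y \<in> U) uniformity)"

instance
proof
  fix x y z :: quat and r :: real and S :: "quat set"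
  show "inner x y = inner y x"
    by (simp add: inner_quat_def mult.commute)
  show "inner (x + y) z = inner x z + inner y z"
    by (simp add: inner_quat_def distrib_right)
  show "inner (r *\<^sub>R x) y = r * inner x y"
    by (simp add: inner_quat_def distrib_left)
  show "0 \<le> inner x x"
    by (simp add: inner_quat_def)
  show "inner x x = 0 \<longleftrightarrow> x = 0"
    by (simp add: inner_quat_def add_nonneg_eq_0_iff quat_eq_iff)
  show "norm x = sqrt (inner x x)"
    by (simp add: norm_quat_def inner_quat_def power2_eq_square)
qed (rule sgn_quat_def dist_quat_def open_quat_def uniformity_quat_def)+

end

instantiation quat :: real_normed_div_algebra
begin

definition inverse_quat_def: "inverse x = qcnj x /\<^sub>R (norm x)\<^sup>2"

definition divide_quat_def: "x div (y :: quat) = x * inverse y"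

lemma norm_quat_power2:
  "(norm x)\<^sup>2 = (qRe x)\<^sup>2 + (qI x)\<^sup>2 + (qJ x)\<^sup>2 + (qK x)\<^sup>2" for x :: quat
  by (simp add: norm_quat_def)

lemma qcnj_mult_self: "qcnj x * x = of_real ((norm x)\<^sup>2)" "x * qcnj x = of_real ((norm x)\<^sup>2)"
  unfolding norm_quat_power2
  by (simp_all add: quat_eq_iff of_real_def power2_eq_square algebra_simps)

instance
proof
  fix x y :: quat
  show "x \<noteq> 0 \<Longrightarrow> inverse x * x = 1" "x \<noteq> 0 \<Longrightarrow> x * inverse x = 1"
    by (simp_all add: inverse_quat_def qcnj_mult_self of_real_def)
  show "x div y = x * inverse y"
    by (rule divide_quat_def)
  show "inverse (0 :: quat) = 0"
    by (simp add: inverse_quat_def quat_eq_iff)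
  have "(norm (x * y))\<^sup>2 = (norm x * norm y)\<^sup>2"
    unfolding power_mult_distrib norm_quat_power2 by (simp add: power2_eq_square algebra_simps)
  thus "norm (x * y) = norm x * norm y"
    by (rule power2_eq_imp_eq) auto
qed

end

section \<open>Positive definite sequences\<close>

definition toeplitz :: "(int \<Rightarrow> quat) \<Rightarrow> nat \<Rightarrow> nat \<Rightarrow> quat" where
  "toeplitz c k l = c (int l - int k)"

text \<open>\<open>toeplitz_form c n \<xi>\<close> is $\xi^* T_n(c)\, \xi$, where \<open>\<xi> 0, \<dots>, \<xi> n\<close> are the entries of a
  column vector of length $n+1$; further values of \<open>\<xi>\<close> are irrelevant.\<close>

definition toeplitz_form :: "(int \<Rightarrow> quat) \<Rightarrow> nat \<Rightarrow> (nat \<Rightarrow> quat) \<Rightarrow> quat" where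
  "toeplitz_form c n \<xi> = (\<Sum>k\<le>n. \<Sum>l\<le>n. qcnj (\<xi> k) * toeplitz c k l * \<xi> l)"

text \<open>For a quaternion, being $\ge 0$ (or $> 0$) includes being real.\<close>

definition positive_definite_seq :: "(int \<Rightarrow> quat) \<Rightarrow> bool" where
  "positive_definite_seq c \<longleftrightarrow> (\<forall>n \<xi>. \<exists>r::real. r \<ge> 0 \<and> toeplitz_form c n \<xi> = of_real r)"

definition nontrivial_positive_definite_seq :: "(int \<Rightarrow> quat) \<Rightarrow> bool" where
  "nontrivial_positive_definite_seq c \<longleftrightarrow> positive_definite_seq c \<and>
     (\<forall>n \<xi>. (\<exists>k\<le>n. \<xi> k \<noteq> 0) \<longrightarrow> (\<exists>r::real. r > 0 \<and> toeplitz_form c n \<xi> = of_real r))"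

section \<open>Polynomials with quaternionic coefficients\<close>

text \<open>Elements of $\mathbb{H}[p]^L$ and of $\mathbb{H}[p]^R$ are both represented by their
  coefficient sequences, as values of type \<open>quat poly\<close>. The two spaces differ in how a polynomial
  is evaluated: \<open>evalL\<close> is for $\mathbb{H}[p]^L$ (powers on the left, coefficients on the right),
  \<open>evalR\<close> for $\mathbb{H}[p]^R$. The library's \<open>poly\<close> and \<open>smult\<close> require a commutative
  coefficient ring and are not available.\<close>

definition evalL :: "quat poly \<Rightarrow> quat \<Rightarrow> quat" where
  "evalL \<phi> p = (\<Sum>k\<le>degree \<phi>. p ^ k * coeff \<phi> k)"

definition evalR :: "quat poly \<Rightarrow> quat \<Rightarrow> quat" where
  "evalR \<phi> p = (\<Sum>k\<le>degree \<phi>. coeff \<phi> k * p ^ k)"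

definition zerosL :: "quat poly \<Rightarrow> quat set" where
  "zerosL \<phi> = {q. evalL \<phi> q = 0}"

definition zerosR :: "quat poly \<Rightarrow> quat set" where
  "zerosR \<phi> = {q. evalR \<phi> q = 0}"

text \<open>The reverse of $\sum_k p^k \varphi_k$ is $\sum_k \overline{\varphi_k}\, p^{n-k}$ and the
  reverse of $\sum_k \psi_k p^k$ is $\sum_k p^{n-k}\, \overline{\psi_k}$, where $n$ is the degree. On
  coefficient sequences this is one and the same map, but it exchanges $\mathbb{H}[p]^L$ and
  $\mathbb{H}[p]^R$.\<close>

definition reverse_qpoly :: "quat poly \<Rightarrow> quat poly" where
  "reverse_qpoly \<phi> = reflect_poly (map_poly qcnj \<phi>)"

section \<open>Orthonormal polynomials\<close>

definition innerR :: "(int \<Rightarrow> quat) \<Rightarrow> quat poly \<Rightarrow> quat poly \<Rightarrow> quat" where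
  "innerR c \<phi> \<psi> =
     (\<Sum>k\<le>degree \<phi>. \<Sum>l\<le>degree \<psi>. qcnj (coeff \<psi> l) * c (int k - int l) * coeff \<phi> k)"

definition innerL :: "(int \<Rightarrow> quat) \<Rightarrow> quat poly \<Rightarrow> quat poly \<Rightarrow> quat" where
  "innerL c \<phi> \<psi> =
     (\<Sum>k\<le>degree \<phi>. \<Sum>l\<le>degree \<psi>. coeff \<phi> k * c (int k - int l) * qcnj (coeff \<psi> l))"

definition mult_scalar_right :: "quat poly \<Rightarrow> quat \<Rightarrow> quat poly" where
  "mult_scalar_right \<phi> a = map_poly (\<lambda>x. x * a) \<phi>"

definition mult_scalar_left :: "quat \<Rightarrow> quat poly \<Rightarrow> quat poly" where
  "mult_scalar_left a \<phi> = map_poly (\<lambda>x. a * x) \<phi>"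

text \<open>Gram--Schmidt applied to $1, p, p^2, \dots$. The form \<open>innerR\<close> is linear in its first argument
  for multiplication by scalars on the right, and $\mathbb{H}[p]^L$ is treated as a right vector
  space; \<open>innerL\<close> and $\mathbb{H}[p]^R$ are the mirror image. In both recursions \<open>\<phi>\<close> is the $n$-th
  monic orthogonal polynomial, and the square of its norm is a positive real number whenever \<open>c\<close> is
  a non-trivial positive definite sequence.\<close>

fun orthonormal_polyR :: "(int \<Rightarrow> quat) \<Rightarrow> nat \<Rightarrow> quat poly" where
  "orthonormal_polyR c n =
     (let \<phi> = monom 1 n - (\<Sum>j<n. mult_scalar_right (orthonormal_polyR c j)
                                  (innerR c (monom 1 n) (orthonormal_polyR c j)))
      in mult_scalar_right \<phi> (of_real (1 / sqrt (qRe (innerR c \<phi> \<phi>)))))"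

fun orthonormal_polyL :: "(int \<Rightarrow> quat) \<Rightarrow> nat \<Rightarrow> quat poly" where
  "orthonormal_polyL c n =
     (let \<phi> = monom 1 n - (\<Sum>j<n. mult_scalar_left (innerL c (monom 1 n) (orthonormal_polyL c j))
                                  (orthonormal_polyL c j))
      in mult_scalar_left (of_real (1 / sqrt (qRe (innerL c \<phi> \<phi>)))) \<phi>)"

declare orthonormal_polyR.simps [simp del] orthonormal_polyL.simps [simp del]

end

theory Submission
  imports Defs
begin

text \<open>Put $c'_i = c_{-i} = \overline{c_i}$, let $\Phi_n$, $\Phi'_n \in \mathbb{H}[p]^L$ be the monic
  right-orthogonal polynomials of $c$, $c'$, and let $\Phi^*_n$ be $\Phi'_n$ with its coefficients in
  reverse order. Comparing moments gives the Szego recurrences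
  $\Phi_{n+1} = p\Phi_n - \Phi^*_n \alpha_n$ and
  $\Phi^*_{n+1} = \Phi^*_n - p\Phi_n \overline{\alpha_n}$ with $|\alpha_n| < 1$. Evaluated at $q$, a
  step maps $(a, x) = (\Phi^*_n(q), q\Phi_n(q))$ to
  $(a - x\overline{\alpha_n}, x - a\alpha_n)$, which multiplies $|a|^2 - |x|^2$ by
  $1 - |\alpha_n|^2$. By induction $|\Phi^*_n(q)| \ge |\Phi_n(q)|$ and $\Phi^*_n(q) \ne 0$ when
  $|q| \le 1$, and $|\Phi_n(q)| \ge |\Phi^*_n(q)|$ and $\Phi_n(q) \ne 0$ when $|q| \ge 1$.
  Conjugating coefficients turns the left-orthonormal polynomials of $c$ into the right-orthonormal
  ones of $c'$, so $\Phi^*_n$ is, up to a positive factor, the reverse of $\psi^L_n$, and the other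
  two inclusions follow by exchanging $c$ and $c'$.\<close>

section \<open>Conjugation and scalar multiples of polynomials\<close>

lemma qcnj_simps [simp]:
  "qcnj (x + y) = qcnj x + qcnj y" "qcnj (x - y) = qcnj x - qcnj y" "qcnj (- x) = - qcnj x"
  "qcnj (x * y) = qcnj y * qcnj x" "qcnj (of_real r) = of_real r"
  "qcnj (r *\<^sub>R x) = r *\<^sub>R qcnj x" "qcnj 0 = 0" "qcnj 1 = 1"
  "qcnj (qcnj x) = x" "norm (qcnj x) = norm x"
  by (simp_all add: quat_eq_iff of_real_def norm_quat_def)

lemma qcnj_sum [simp]: "qcnj (sum f A) = (\<Sum>x\<in>A. qcnj (f x))"
  by (induction A rule: infinite_finite_induct) simp_all

lemma qcnj_eq_0_iff [simp]: "qcnj x = 0 \<longleftrightarrow> x = 0"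
  by (simp add: quat_eq_iff)

lemma qcnj_power [simp]: "qcnj (x ^ k) = qcnj x ^ k"
  by (induction k) (simp_all add: power_commutes)

lemma qRe_of_real [simp]: "qRe (of_real r) = r"
  by (simp add: of_real_def)

lemma coeff_mult_scalar_right [simp]: "coeff (mult_scalar_right \<phi> a) k = coeff \<phi> k * a"
  by (simp add: mult_scalar_right_def coeff_map_poly)

lemma coeff_mult_scalar_left [simp]: "coeff (mult_scalar_left a \<phi>) k = a * coeff \<phi> k"
  by (simp add: mult_scalar_left_def coeff_map_poly)

lemma degree_mult_scalar_right_le: "degree (mult_scalar_right \<phi> a) \<le> degree \<phi>"
  by (rule degree_le) (simp add: coeff_eq_0)

lemma degree_map_poly_qcnj [simp]: "degree (map_poly qcnj \<phi>) = degree \<phi>"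
  by (rule degree_map_poly) simp

lemma map_poly_qcnj_qcnj [simp]: "map_poly qcnj (map_poly qcnj \<phi>) = \<phi>"
  by (rule poly_eqI) (simp add: coeff_map_poly)

lemma reverse_qpoly_map_poly_qcnj [simp]: "reverse_qpoly (map_poly qcnj \<phi>) = reflect_poly \<phi>"
  by (simp add: reverse_qpoly_def)

section \<open>Evaluation and moments\<close>

lemma evalL_bound: "degree \<phi> \<le> N \<Longrightarrow> evalL \<phi> q = (\<Sum>k\<le>N. q ^ k * coeff \<phi> k)"
  unfolding evalL_def by (rule sum.mono_neutral_left) (auto simp: coeff_eq_0)

lemma evalL_diff: "evalL (\<phi> - \<psi>) q = evalL \<phi> q - evalL \<psi> q"
proof -
  define N where "N = max (degree \<phi>) (degree \<psi>)"
  have "degree (\<phi> - \<psi>) \<le> N" "degree \<phi> \<le> N" "degree \<psi> \<le> N"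
    using degree_diff_le_max[of \<phi> \<psi>] by (auto simp: N_def)
  thus ?thesis by (simp add: evalL_bound[of _ N] right_diff_distrib sum_subtractf)
qed

lemma evalL_mult_scalar_right: "evalL (mult_scalar_right \<phi> a) q = evalL \<phi> q * a"
  using degree_mult_scalar_right_le[of \<phi> a]
  by (simp add: evalL_bound[of _ "degree \<phi>"] sum_distrib_right mult.assoc)

lemma evalL_pCons_0: "evalL (pCons 0 \<phi>) q = q * evalL \<phi> q"
  using degree_pCons_le[of 0 \<phi>]
  by (simp add: evalL_bound[of _ "Suc (degree \<phi>)"] evalL_def sum.atMost_Suc_shift
      sum_distrib_left mult.assoc del: sum.atMost_Suc)

text \<open>Conjugation reverses products, so it moves the coefficients to the other side of the
  powers.\<close>

lemma evalR_eq_evalL: "evalR \<phi> q = qcnj (evalL (map_poly qcnj \<phi>) (qcnj q))"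
  by (simp add: evalR_def evalL_def coeff_map_poly)

text \<open>\<open>momentR c \<phi> m\<close> is $\langle \varphi, p^m\rangle_R$. Negative $m$ are allowed, so that
  multiplication by $p$ is a shift of $m$.\<close>

definition momentR :: "(int \<Rightarrow> quat) \<Rightarrow> quat poly \<Rightarrow> int \<Rightarrow> quat" where
  "momentR c \<phi> m = (\<Sum>k\<le>degree \<phi>. c (int k - m) * coeff \<phi> k)"

lemma momentR_bound: "degree \<phi> \<le> N \<Longrightarrow> momentR c \<phi> m = (\<Sum>k\<le>N. c (int k - m) * coeff \<phi> k)"
  unfolding momentR_def by (rule sum.mono_neutral_left) (auto simp: coeff_eq_0)

lemma momentR_diff: "momentR c (\<phi> - \<psi>) m = momentR c \<phi> m - momentR c \<psi> m"
proof -
  define N where "N = max (degree \<phi>) (degree \<psi>)"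
  have "degree (\<phi> - \<psi>) \<le> N" "degree \<phi> \<le> N" "degree \<psi> \<le> N"
    using degree_diff_le_max[of \<phi> \<psi>] by (auto simp: N_def)
  thus ?thesis by (simp add: momentR_bound[of _ N] right_diff_distrib sum_subtractf)
qed

lemma momentR_0 [simp]: "momentR c 0 m = 0"
  by (simp add: momentR_def)

lemma momentR_add: "momentR c (\<phi> + \<psi>) m = momentR c \<phi> m + momentR c \<psi> m"
  using momentR_diff[of c "\<phi> + \<psi>" \<psi> m] by simp

lemma momentR_sum: "momentR c (sum f A) m = (\<Sum>x\<in>A. momentR c (f x) m)"
  by (induction A rule: infinite_finite_induct) (simp_all add: momentR_add)

lemma momentR_mult_scalar_right: "momentR c (mult_scalar_right \<phi> a) m = momentR c \<phi> m * a"
  using degree_mult_scalar_right_le[of \<phi> a]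
  by (simp add: momentR_bound[of _ "degree \<phi>"] sum_distrib_right mult.assoc)

lemma momentR_pCons_0: "momentR c (pCons 0 \<phi>) m = momentR c \<phi> (m - 1)"
  using degree_pCons_le[of 0 \<phi>]
  by (simp add: momentR_bound[of _ "Suc (degree \<phi>)"] momentR_def[of c \<phi>] sum.atMost_Suc_shift
      algebra_simps del: sum.atMost_Suc)

text \<open>The substitution k -> degree - k turns the index k - m into the negative of k - (degree
  - m), which is why the reflected sequence appears.\<close>

lemma momentR_reflect_poly:
  "momentR c (reflect_poly \<phi>) m = momentR (\<lambda>i. c (- i)) \<phi> (int (degree \<phi>) - m)"
proof -
  have "momentR c (reflect_poly \<phi>) m
      = (\<Sum>k\<le>degree \<phi>. c (int k - m) * coeff \<phi> (degree \<phi> - k))"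
    by (simp add: momentR_bound[OF degree_reflect_poly_le] coeff_reflect_poly)
  also have "\<dots> = momentR (\<lambda>i. c (- i)) \<phi> (int (degree \<phi>) - m)"
    unfolding momentR_def
    by (rule sum.reindex_bij_witness[of _ "\<lambda>k. degree \<phi> - k" "\<lambda>k. degree \<phi> - k"])
       (auto simp: of_nat_diff algebra_simps)
  finally show ?thesis .
qed

lemma innerR_eq_momentR:
  assumes "degree \<psi> \<le> N"
  shows "innerR c \<phi> \<psi> = (\<Sum>l\<le>N. qcnj (coeff \<psi> l) * momentR c \<phi> (int l))"
proof -
  have "innerR c \<phi> \<psi> = (\<Sum>l\<le>degree \<psi>. qcnj (coeff \<psi> l) * momentR c \<phi> (int l))"
    unfolding innerR_def momentR_def
    by (subst sum.swap) (simp add: sum_distrib_left mult.assoc)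
  also have "\<dots> = (\<Sum>l\<le>N. qcnj (coeff \<psi> l) * momentR c \<phi> (int l))"
    using assms by (intro sum.mono_neutral_left) (auto simp: coeff_eq_0)
  finally show ?thesis .
qed

text \<open>The workhorse for norms and inner products: orthogonality kills all moments but one, or
  the remaining coefficients of \<psi> vanish.\<close>

lemma innerR_eq_single_moment:
  assumes "degree \<psi> \<le> N" "m \<le> N"
    and "\<And>l. l \<le> N \<Longrightarrow> l \<noteq> m \<Longrightarrow> coeff \<psi> l = 0 \<or> momentR c \<phi> (int l) = 0"
  shows "innerR c \<phi> \<psi> = qcnj (coeff \<psi> m) * momentR c \<phi> (int m)"
proof -
  have "innerR c \<phi> \<psi> = (\<Sum>l\<le>N. qcnj (coeff \<psi> l) * momentR c \<phi> (int l))"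
    by (rule innerR_eq_momentR) fact
  also have "\<dots> = (\<Sum>l\<in>{m}. qcnj (coeff \<psi> l) * momentR c \<phi> (int l))"
    using assms by (intro sum.mono_neutral_right) auto
  finally show ?thesis by simp
qed

lemma innerR_eq_toeplitz_form: "innerR c \<phi> \<phi> = toeplitz_form c (degree \<phi>) (coeff \<phi>)"
  unfolding innerR_def toeplitz_form_def toeplitz_def by (subst sum.swap) simp

lemma sum_two:
  fixes f :: "nat \<Rightarrow> 'a::ab_group_add"
  assumes "0 < n" "\<And>k. k \<noteq> 0 \<Longrightarrow> k \<noteq> n \<Longrightarrow> f k = 0"
  shows "(\<Sum>k\<le>n. f k) = f 0 + f n"
proof -
  have "(\<Sum>k\<le>n. f k) = (\<Sum>k\<in>{0,n}. f k)"
    using assms by (intro sum.mono_neutral_right) auto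
  thus ?thesis using assms by simp
qed

section \<open>Hermitian symmetry, positivity and reflection of the sequence\<close>

text \<open>Polarization: the form is real on every vector, and vectors supported on the indices 0
  and n isolate \<open>c n\<close> and \<open>c (- n)\<close>.\<close>

lemma positive_definite_seq_hermitian:
  assumes "positive_definite_seq c"
  shows "c (- i) = qcnj (c i)"
proof -
  have real: "\<exists>r. toeplitz_form c n \<xi> = of_real r" for n \<xi>
    using assms unfolding positive_definite_seq_def by metis
  have c0: "qI (c 0) = 0" "qJ (c 0) = 0" "qK (c 0) = 0"
    using real[of 0 "\<lambda>_. 1"] by (auto simp: toeplitz_form_def toeplitz_def of_real_def)
  have nat_case: "c (- int n) = qcnj (c (int n))" for n
  proof (cases "n = 0")
    case True
    thus ?thesis using c0 by (simp add: quat_eq_iff)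
  next
    case False
    have form: "\<exists>r. c 0 + c (int n) * x + qcnj x * c (- int n) + qcnj x * c 0 * x = of_real r"
      for x :: quat
    proof -
      define \<xi> where "\<xi> = (\<lambda>k. if k = 0 then 1 else if k = n then x else 0)"
      have "toeplitz_form c n \<xi>
          = c 0 + c (int n) * x + qcnj x * c (- int n) + qcnj x * c 0 * x"
        using False unfolding toeplitz_form_def toeplitz_def
        by (simp add: sum_two \<xi>_def algebra_simps)
      thus ?thesis using real[of n \<xi>] by simp
    qed
    \<comment> \<open>With x = 1 the imaginary parts of \<open>c n\<close> and
      \<open>c (- n)\<close> are opposite; with x = i the real parts are equal.\<close>
    from form[of 1] form[of "Quat 0 1 0 0"] show ?thesis
      using c0 by (auto simp: quat_eq_iff of_real_def)
  qed
  show ?thesis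
    using nat_case[of "nat i"] nat_case[of "nat (- i)"]
    by (cases "i \<ge> 0") simp_all
qed

lemma innerR_hermitian:
  assumes "positive_definite_seq c"
  shows "qcnj (innerR c \<phi> \<psi>) = innerR c \<psi> \<phi>"
proof -
  have "qcnj (c (int k - int l)) = c (int l - int k)" for k l
    using positive_definite_seq_hermitian[OF assms, of "int k - int l"] by simp
  thus ?thesis
    unfolding innerR_def by (subst sum.swap) (simp add: mult.assoc)
qed

lemma innerR_pos:
  assumes "nontrivial_positive_definite_seq c" "\<phi> \<noteq> 0"
  obtains h where "h > 0" "innerR c \<phi> \<phi> = of_real h"
proof -
  have "\<exists>k\<le>degree \<phi>. coeff \<phi> k \<noteq> 0"
    using assms(2) leading_coeff_0_iff by blast
  thus thesis
    using assms(1) that unfolding nontrivial_positive_definite_seq_def innerR_eq_toeplitz_form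
    by blast
qed

text \<open>Reversing the order of rows and columns transposes the index pattern of a Toeplitz
  matrix.\<close>

lemma toeplitz_form_reflect:
  "toeplitz_form (\<lambda>i. c (- i)) n \<xi> = toeplitz_form c n (\<lambda>k. \<xi> (n - k))"
proof -
  have rev: "(\<Sum>k\<le>n. g k) = (\<Sum>k\<le>n. g (n - k))" for g :: "nat \<Rightarrow> quat"
    by (rule sum.reindex_bij_witness[of _ "\<lambda>k. n - k" "\<lambda>k. n - k"]) auto
  show ?thesis
    unfolding toeplitz_form_def toeplitz_def
    by (subst (2) rev, rule sum.cong[OF refl], subst rev) (simp add: of_nat_diff)
qed

lemma nontrivial_positive_definite_seq_reflect:
  assumes "nontrivial_positive_definite_seq c"
  shows "nontrivial_positive_definite_seq (\<lambda>i. c (- i))"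
proof -
  have "\<exists>k\<le>n. \<xi> (n - k) \<noteq> 0" if "\<exists>k\<le>n. \<xi> k \<noteq> 0" for n and \<xi> :: "nat \<Rightarrow> quat"
    using that by (metis diff_diff_cancel diff_le_self)
  thus ?thesis
    using assms
    unfolding nontrivial_positive_definite_seq_def positive_definite_seq_def toeplitz_form_reflect
    by simp
qed

section \<open>Monic orthogonal polynomials\<close>

text \<open>The polynomial inside the recursion of \<open>orthonormal_polyR\<close> before
  normalisation.\<close>

definition monic_orthogonalR :: "(int \<Rightarrow> quat) \<Rightarrow> nat \<Rightarrow> quat poly" where
  "monic_orthogonalR c n = monom 1 n - (\<Sum>j<n. mult_scalar_right (orthonormal_polyR c j)
     (innerR c (monom 1 n) (orthonormal_polyR c j)))"

lemma orthonormal_polyR_eq: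
  "orthonormal_polyR c n = mult_scalar_right (monic_orthogonalR c n)
     (of_real (1 / sqrt (qRe (innerR c (monic_orthogonalR c n) (monic_orthogonalR c n)))))"
  by (subst orthonormal_polyR.simps) (simp add: monic_orthogonalR_def Let_def)

lemma monic_orthogonalR_0: "monic_orthogonalR c 0 = [:1:]"
  by (simp add: monic_orthogonalR_def monom_0)

locale nontrivial_pd =
  fixes c :: "int \<Rightarrow> quat"
  assumes nontriv: "nontrivial_positive_definite_seq c"
begin

text \<open>The leading terms cancel in the difference, whose moments below n all vanish; so its
  norm is 0, and positivity forces it to be 0.\<close>

lemma monic_moments_unique:
  assumes "degree \<phi> \<le> n" "coeff \<phi> n = 1" "\<And>l. l < n \<Longrightarrow> momentR c \<phi> (int l) = 0"
    and "degree \<psi> \<le> n" "coeff \<psi> n = 1" "\<And>l. l < n \<Longrightarrow> momentR c \<psi> (int l) = 0"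
  shows "\<phi> = \<psi>"
proof (rule ccontr)
  assume "\<phi> \<noteq> \<psi>"
  then obtain h where h: "h > 0" "innerR c (\<phi> - \<psi>) (\<phi> - \<psi>) = of_real h"
    using innerR_pos[OF nontriv, of "\<phi> - \<psi>"] by auto
  have "degree (\<phi> - \<psi>) \<le> n" using assms by (simp add: degree_diff_le)
  hence "innerR c (\<phi> - \<psi>) (\<phi> - \<psi>)
      = qcnj (coeff (\<phi> - \<psi>) n) * momentR c (\<phi> - \<psi>) (int n)"
    using assms by (intro innerR_eq_single_moment) (auto simp: momentR_diff)
  thus False using h assms by simp
qed

text \<open>Only the moment at n contributes to the norm, with coefficient 1. Stated for any
  polynomial with these properties, so that it can serve inside the induction that establishes
  them.\<close>

lemma monic_moments_norm:
  assumes "degree \<phi> \<le> n" "coeff \<phi> n = 1" "\<And>l. l < n \<Longrightarrow> momentR c \<phi> (int l) = 0"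
  obtains h where "h > 0" "momentR c \<phi> (int n) = of_real h" "innerR c \<phi> \<phi> = of_real h"
proof -
  have "innerR c \<phi> \<phi> = qcnj (coeff \<phi> n) * momentR c \<phi> (int n)"
    using assms by (intro innerR_eq_single_moment) auto
  moreover have "\<phi> \<noteq> 0" using assms by auto
  ultimately show thesis
    using innerR_pos[OF nontriv, of \<phi>] assms(2) that by auto
qed

text \<open>Strong induction: the properties for smaller indices make the earlier
  \<open>?R j\<close> orthonormal, so the Gram-Schmidt subtraction does remove the components along
  them.\<close>

lemma monic_orthogonalR_props:
  "degree (monic_orthogonalR c n) \<le> n \<and> coeff (monic_orthogonalR c n) n = 1 \<and>
   (\<forall>l<n. momentR c (monic_orthogonalR c n) (int l) = 0)"
proof (induction n rule: less_induct)
  case (less n)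
  let ?R = "orthonormal_polyR c" and ?\<Phi> = "monic_orthogonalR c"
  have R: "degree (?R j) \<le> j" "coeff (?R j) j \<noteq> 0" "\<And>l. l < j \<Longrightarrow> momentR c (?R j) (int l) = 0"
    "innerR c (?R j) (?R j) = 1" if "j < n" for j
  proof -
    have P: "degree (?\<Phi> j) \<le> j" "coeff (?\<Phi> j) j = 1" "\<And>l. l < j \<Longrightarrow> momentR c (?\<Phi> j) (int l) = 0"
      using less[OF that] by auto
    from monic_moments_norm[OF P] obtain h
      where h: "h > 0" "momentR c (?\<Phi> j) (int j) = of_real h" "innerR c (?\<Phi> j) (?\<Phi> j) = of_real h"
      by blast
    have eq: "?R j = mult_scalar_right (?\<Phi> j) (of_real (1 / sqrt h))"
      by (subst orthonormal_polyR_eq) (simp add: h)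
    show deg: "degree (?R j) \<le> j"
      using degree_mult_scalar_right_le[of "?\<Phi> j"] P(1) unfolding eq by (rule order_trans)
    show "coeff (?R j) j \<noteq> 0" using P h by (simp add: eq del: of_real_divide)
    show orth: "momentR c (?R j) (int l) = 0" if "l < j" for l
      using P(3)[OF that] by (simp add: eq momentR_mult_scalar_right)
    have "innerR c (?R j) (?R j) = qcnj (coeff (?R j) j) * momentR c (?R j) (int j)"
      using deg orth by (intro innerR_eq_single_moment) auto
    also have "\<dots> = of_real (1 / sqrt h * (h * (1 / sqrt h)))"
      unfolding eq momentR_mult_scalar_right coeff_mult_scalar_right h P qcnj_simps of_real_mult
      by simp
    also have "1 / sqrt h * (h * (1 / sqrt h)) = 1"
      using h(1) by (simp add: field_simps)
    finally show "innerR c (?R j) (?R j) = 1" by simp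
  qed
  \<comment> \<open>The moments of \<open>?R j\<close> vanish below j, which covers all coefficients
    of \<open>?R i\<close>; the case i > j follows by Hermitian symmetry.\<close>
  have below: "innerR c (?R j) (?R i) = 0" if "i < j" "j < n" for i j
    using R(1)[of i] R(3)[of j] that
    by (subst innerR_eq_momentR[of _ i]) auto
  have pd: "positive_definite_seq c"
    using nontriv by (simp add: nontrivial_positive_definite_seq_def)
  have ortho: "innerR c (?R j) (?R i) = (if i = j then 1 else 0)" if "i < n" "j < n" for i j
    using below[of i j] below[of j i] R(4)[of j] that innerR_hermitian[OF pd, of "?R i" "?R j"]
    by (cases i j rule: linorder_cases) auto
  have deg: "degree (?\<Phi> n) \<le> n"
    unfolding monic_orthogonalR_def
    by (intro degree_diff_le degree_monom_le degree_sum_le)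
       (auto intro!: order_trans[OF degree_mult_scalar_right_le] intro: order_trans[OF R(1)])
  have coeff: "coeff (?\<Phi> n) n = 1"
  proof -
    have "coeff (?R j) n = 0" if "j < n" for j
      using R(1)[OF that] that by (simp add: coeff_eq_0)
    thus ?thesis by (simp add: monic_orthogonalR_def coeff_sum)
  qed
  have innerR_lin: "innerR c (?\<Phi> n) \<psi> = innerR c (monom 1 n) \<psi>
      - (\<Sum>j<n. innerR c (?R j) \<psi> * innerR c (monom 1 n) (?R j))" for \<psi>
  proof -
    have "innerR c (?\<Phi> n) \<psi> = innerR c (monom 1 n) \<psi>
      - (\<Sum>l\<le>degree \<psi>. \<Sum>j<n. qcnj (coeff \<psi> l) * momentR c (?R j) (int l) *
           innerR c (monom 1 n) (?R j))"
      by (simp add: innerR_eq_momentR[of \<psi>, OF order_refl] monic_orthogonalR_def momentR_diff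
          momentR_sum momentR_mult_scalar_right right_diff_distrib sum_subtractf sum_distrib_left
          mult.assoc)
    also have "(\<Sum>l\<le>degree \<psi>. \<Sum>j<n. qcnj (coeff \<psi> l) * momentR c (?R j) (int l) *
           innerR c (monom 1 n) (?R j)) = (\<Sum>j<n. innerR c (?R j) \<psi> * innerR c (monom 1 n) (?R j))"
      by (subst sum.swap) (simp add: innerR_eq_momentR[of \<psi>, OF order_refl] sum_distrib_right)
    finally show ?thesis .
  qed
  have orth: "innerR c (?\<Phi> n) (?R i) = 0" if "i < n" for i
  proof -
    have "(\<Sum>j<n. innerR c (?R j) (?R i) * innerR c (monom 1 n) (?R j))
        = (\<Sum>j<n. if i = j then innerR c (monom 1 n) (?R j) else 0)"
      using that by (intro sum.cong) (auto simp: ortho)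
    thus ?thesis using that by (simp add: innerR_lin)
  qed
  \<comment> \<open>Orthogonality to the \<open>?R l\<close> becomes vanishing of moments by a
    triangular argument: \<open>?R l\<close> has degree at most l, the smaller moments are already
    0, and its coefficient at l is nonzero.\<close>
  have "momentR c (?\<Phi> n) (int l) = 0" if "l < n" for l
    using that
  proof (induction l rule: less_induct)
    case (less l)
    have "0 = qcnj (coeff (?R l) l) * momentR c (?\<Phi> n) (int l)"
      unfolding orth[OF less.prems, symmetric] using R(1)[OF less.prems] less
      by (intro innerR_eq_single_moment) auto
    thus ?case using R(2)[OF less.prems] by simp
  qed
  with deg coeff show ?case by blast
qed

lemma degree_monic_orthogonalR [simp]: "degree (monic_orthogonalR c n) = n"
  using monic_orthogonalR_props[of n] by (intro antisym le_degree) auto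

lemma coeff_monic_orthogonalR [simp]: "coeff (monic_orthogonalR c n) n = 1"
  using monic_orthogonalR_props[of n] by blast

lemma momentR_monic_orthogonalR [simp]:
  assumes "0 \<le> m" "m < int n"
  shows "momentR c (monic_orthogonalR c n) m = 0"
  using monic_orthogonalR_props[of n] assms zero_le_imp_eq_int[of m] by auto

definition norm2 :: "nat \<Rightarrow> real" where
  "norm2 n = qRe (momentR c (monic_orthogonalR c n) (int n))"

lemma norm2_pos: "norm2 n > 0"
  and momentR_eq_norm2: "momentR c (monic_orthogonalR c n) (int n) = of_real (norm2 n)"
  and innerR_eq_norm2:
    "innerR c (monic_orthogonalR c n) (monic_orthogonalR c n) = of_real (norm2 n)"
proof -
  obtain h where "h > 0" "momentR c (monic_orthogonalR c n) (int n) = of_real h"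
    "innerR c (monic_orthogonalR c n) (monic_orthogonalR c n) = of_real h"
    by (rule monic_moments_norm[of "monic_orthogonalR c n" n]) auto
  thus "norm2 n > 0" "momentR c (monic_orthogonalR c n) (int n) = of_real (norm2 n)"
    "innerR c (monic_orthogonalR c n) (monic_orthogonalR c n) = of_real (norm2 n)"
    by (simp_all add: norm2_def)
qed

lemma zerosL_orthonormal_polyR: "zerosL (orthonormal_polyR c n) = zerosL (monic_orthogonalR c n)"
  using norm2_pos[of n]
  by (subst orthonormal_polyR_eq)
     (simp add: zerosL_def evalL_mult_scalar_right innerR_eq_norm2 del: of_real_divide)

text \<open>Reversal depends on the degree, so it commutes with the normalising factor only because
  that factor is nonzero and the degree stays n.\<close>

lemma zerosL_reflect_orthonormal_polyR:
  "zerosL (reflect_poly (orthonormal_polyR c n)) = zerosL (reflect_poly (monic_orthogonalR c n))"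
proof -
  define r where "r = 1 / sqrt (norm2 n)"
  have r: "r \<noteq> 0" using norm2_pos[of n] by (simp add: r_def)
  have eq: "orthonormal_polyR c n = mult_scalar_right (monic_orthogonalR c n) (of_real r)"
    by (subst orthonormal_polyR_eq) (simp add: innerR_eq_norm2 r_def)
  have "degree (orthonormal_polyR c n) = n"
  proof (rule antisym)
    show "degree (orthonormal_polyR c n) \<le> n"
      unfolding eq using degree_mult_scalar_right_le[of "monic_orthogonalR c n"] by simp
    show "n \<le> degree (orthonormal_polyR c n)"
      using r by (intro le_degree) (simp add: eq)
  qed
  hence "reflect_poly (orthonormal_polyR c n)
      = mult_scalar_right (reflect_poly (monic_orthogonalR c n)) (of_real r)"
    by (intro poly_eqI) (simp add: coeff_reflect_poly eq)
  thus ?thesis using r by (simp add: zerosL_def evalL_mult_scalar_right)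
qed

end

section \<open>Szego recurrences\<close>

text \<open>Holds a sequence together with its reflection; interpreting it at the reflection
  exchanges the two roles.\<close>

locale nontrivial_pd_pair = nontrivial_pd c + rfl: nontrivial_pd "\<lambda>i. c (- i)" for c

lemma nontrivial_pd_pair:
  assumes "nontrivial_positive_definite_seq c"
  shows "nontrivial_pd_pair c"
  using assms nontrivial_positive_definite_seq_reflect[OF assms]
  by (simp add: nontrivial_pd_pair_def nontrivial_pd_def)

context nontrivial_pd_pair
begin

abbreviation "\<Phi> \<equiv> monic_orthogonalR c"
abbreviation "\<Phi>' \<equiv> monic_orthogonalR (\<lambda>i. c (- i))"

text \<open>The factor forced by the recurrence: the moment at 0 of p times \<open>\<Phi> n\<close>
  divided by that of the reversed \<open>\<Phi>' n\<close>, which is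
  \<open>rfl.norm2 n\<close>.\<close>

definition "verblunsky n = momentR c (\<Phi> n) (- 1) /\<^sub>R rfl.norm2 n"

lemma momentR_star: "momentR c (reflect_poly (\<Phi>' n)) m = momentR (\<lambda>i. c (- i)) (\<Phi>' n) (int n - m)"
  by (simp add: momentR_reflect_poly)

text \<open>Both terms on the right have vanishing moments at 1, ..., n, and the choice of
  \<open>verblunsky n\<close> cancels the moment at 0. Uniqueness then identifies the
  polynomial.\<close>

lemma monic_orthogonalR_Suc:
  "\<Phi> (Suc n) = pCons 0 (\<Phi> n) - mult_scalar_right (reflect_poly (\<Phi>' n)) (verblunsky n)"
  (is "_ = ?X")
proof (rule monic_moments_unique[of _ "Suc n"])
  have "degree (reflect_poly (\<Phi>' n)) \<le> n"
    using degree_reflect_poly_le[of "\<Phi>' n"] by simp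
  hence deg: "degree (mult_scalar_right (reflect_poly (\<Phi>' n)) (verblunsky n)) \<le> Suc n"
    using degree_mult_scalar_right_le le_SucI le_trans by meson
  thus "degree ?X \<le> Suc n"
    using degree_pCons_le[of 0 "\<Phi> n"] by (intro degree_diff_le) auto
  show "coeff ?X (Suc n) = 1"
    by (simp add: coeff_reflect_poly)
  show "momentR c ?X (int l) = 0" if "l < Suc n" for l
    using that rfl.norm2_pos[of n]
    by (cases "l = 0")
       (auto simp: momentR_diff momentR_mult_scalar_right momentR_pCons_0 momentR_star
         rfl.momentR_eq_norm2 verblunsky_def of_real_def)
qed auto

text \<open>Take the moment at n + 1 of the recurrence.\<close>

lemma norm2_Suc_aux:
  "of_real (norm2 (Suc n))
    = of_real (norm2 n) - momentR (\<lambda>i. c (- i)) (\<Phi>' n) (- 1) * verblunsky n"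
proof -
  have "of_real (norm2 (Suc n)) = momentR c (\<Phi> (Suc n)) (int (Suc n))"
    by (rule momentR_eq_norm2[symmetric])
  also have "\<dots> = of_real (norm2 n) - momentR (\<lambda>i. c (- i)) (\<Phi>' n) (- 1) * verblunsky n"
    by (simp add: monic_orthogonalR_Suc momentR_diff momentR_mult_scalar_right momentR_pCons_0
        momentR_star momentR_eq_norm2)
  finally show ?thesis .
qed

text \<open>The inner product of p times \<open>\<Phi> n\<close> with the reversed
  \<open>\<Phi>' n\<close> reduces to a single moment in either order of the arguments; Hermitian
  symmetry relates the two values.\<close>

lemma momentR_minus_one_reflect:
  "momentR (\<lambda>i. c (- i)) (\<Phi>' n) (- 1) = qcnj (momentR c (\<Phi> n) (- 1))"
proof -
  let ?S = "reflect_poly (\<Phi>' n)" and ?P = "pCons 0 (\<Phi> n)"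
  have "degree ?S \<le> n"
    using degree_reflect_poly_le[of "\<Phi>' n"] by simp
  \<comment> \<open>The moments of \<open>?P\<close> vanish at 1, ..., n, and
    \<open>coeff ?S 0\<close> is the leading coefficient 1 of \<open>\<Phi>' n\<close>.\<close>
  hence "innerR c ?P ?S = qcnj (coeff ?S 0) * momentR c ?P (int 0)"
    by (intro innerR_eq_single_moment[of _ n]) (auto simp: momentR_pCons_0)
  hence 1: "innerR c ?P ?S = momentR c (\<Phi> n) (- 1)"
    by (simp add: momentR_pCons_0)
  \<comment> \<open>The constant coefficient of \<open>?P\<close> is 0 and the moments of
    \<open>?S\<close> vanish at 1, ..., n, leaving only n + 1.\<close>
  have "innerR c ?S ?P = qcnj (coeff ?P (Suc n)) * momentR c ?S (int (Suc n))"
    using degree_pCons_le[of 0 "\<Phi> n"]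
    by (intro innerR_eq_single_moment[of _ "Suc n"]) (auto simp: momentR_star coeff_pCons split: nat.split)
  hence 2: "innerR c ?S ?P = momentR (\<lambda>i. c (- i)) (\<Phi>' n) (- 1)"
    by (simp add: momentR_star)
  have "positive_definite_seq c"
    using nontriv by (simp add: nontrivial_positive_definite_seq_def)
  from innerR_hermitian[OF this, of ?P ?S] show ?thesis by (simp add: 1 2)
qed

end

text \<open>Both sequences of squared norms start at the real part of \<open>c 0\<close> and satisfy
  the same recursion.\<close>

lemma (in nontrivial_pd_pair) norm2_reflect: "rfl.norm2 n = norm2 n"
proof (induction n)
  case 0
  show ?case
    by (simp add: norm2_def rfl.norm2_def monic_orthogonalR_0 momentR_def)
next
  case (Suc n)
  interpret r: nontrivial_pd_pair "\<lambda>i. c (- i)"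
    by (rule nontrivial_pd_pair) (rule rfl.nontriv)
  let ?a = "momentR c (\<Phi> n) (- 1)"
  \<comment> \<open>The two recursions contain this product in opposite orders; both equal the
    squared norm of \<open>?a\<close>.\<close>
  have comm: "qcnj ?a * ?a = ?a * qcnj ?a" by (simp add: qcnj_mult_self)
  have 1: "of_real (norm2 (Suc n)) = of_real (norm2 n) - qcnj ?a * ?a /\<^sub>R norm2 n"
    by (simp add: norm2_Suc_aux momentR_minus_one_reflect verblunsky_def Suc)
  have "of_real (rfl.norm2 (Suc n)) = of_real (norm2 n) - ?a * qcnj ?a /\<^sub>R norm2 n"
    using r.norm2_Suc_aux[of n]
    by (simp add: momentR_minus_one_reflect r.verblunsky_def Suc)
  with 1 comm have "of_real (rfl.norm2 (Suc n)) = (of_real (norm2 (Suc n)) :: quat)" by simp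
  thus ?case by (simp only: of_real_eq_iff)
qed

context nontrivial_pd_pair
begin

text \<open>The recursion divides the squared norms by the factor 1 - |\<alpha>|^2:
  \<open>norm2 (Suc n)\<close> is \<open>norm2 n\<close> times it, and both are positive.\<close>

lemma verblunsky_less_1: "norm (verblunsky n) < 1"
proof -
  let ?a = "momentR c (\<Phi> n) (- 1)"
  have "of_real (norm2 (Suc n)) = of_real (norm2 n) - qcnj ?a * ?a /\<^sub>R norm2 n"
    by (simp add: norm2_Suc_aux momentR_minus_one_reflect verblunsky_def norm2_reflect)
  also have "\<dots> = of_real (norm2 n - (norm ?a)\<^sup>2 / norm2 n)"
    by (simp add: qcnj_mult_self of_real_def algebra_simps divide_inverse)
  finally have "norm2 (Suc n) = norm2 n - (norm ?a)\<^sup>2 / norm2 n"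
    by (simp only: of_real_eq_iff)
  hence "(norm ?a)\<^sup>2 / norm2 n < norm2 n"
    using norm2_pos[of "Suc n"] by simp
  hence "(norm ?a)\<^sup>2 < (norm2 n)\<^sup>2"
    using norm2_pos[of n] by (simp add: field_simps power2_eq_square)
  hence "norm ?a < norm2 n"
    using norm2_pos[of n] by (simp add: power2_less_imp_less)
  thus ?thesis
    using norm2_pos[of n] by (simp add: verblunsky_def norm2_reflect field_simps)
qed

text \<open>The first recurrence for the reflected sequence, with coefficients reversed at degree n
  + 1; its Verblunsky coefficient is the conjugate one.\<close>

lemma reflect_monic_orthogonalR_Suc:
  "reflect_poly (\<Phi>' (Suc n))
    = reflect_poly (\<Phi>' n) - mult_scalar_right (pCons 0 (\<Phi> n)) (qcnj (verblunsky n))"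
proof -
  interpret r: nontrivial_pd_pair "\<lambda>i. c (- i)"
    by (rule nontrivial_pd_pair) (rule rfl.nontriv)
  have v: "r.verblunsky n = qcnj (verblunsky n)"
    by (simp add: r.verblunsky_def verblunsky_def momentR_minus_one_reflect norm2_reflect)
  show ?thesis
  proof (rule poly_eqI)
    fix k
    show "coeff (reflect_poly (\<Phi>' (Suc n))) k = coeff (reflect_poly (\<Phi>' n)
        - mult_scalar_right (pCons 0 (\<Phi> n)) (qcnj (verblunsky n))) k"
    proof (cases k)
      case 0
      thus ?thesis by simp
    next
      case (Suc j)
      \<comment> \<open>Reversal at degree n + 1 sends the index j + 1 to n - j; for j > n the
        reversed coefficients are 0.\<close>
      have "coeff (\<Phi>' (Suc n)) (n - j) = coeff (pCons 0 (\<Phi>' n)) (n - j)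
          - coeff (reflect_poly (\<Phi> n)) (n - j) * qcnj (verblunsky n)"
        using r.monic_orthogonalR_Suc[of n] by (simp add: v)
      moreover have "i = n - Suc j" if "n - j = Suc i" for i
        using that by simp
      ultimately show ?thesis
        using Suc by (auto simp: coeff_reflect_poly coeff_pCons coeff_eq_0 Suc_diff_le split: nat.splits)
    qed
  qed
qed

end

section \<open>One recurrence step at a point, and location of the zeros\<close>

text \<open>The cross terms are twice the real parts of a \<alpha> conj(x) and conj(x) a \<alpha>;
  they cancel because the real part of a product is invariant under cyclic permutation.\<close>

lemma schur_step_identity:
  fixes a x \<alpha> :: quat
  shows "(norm (a - x * qcnj \<alpha>))\<^sup>2 - (norm (x - a * \<alpha>))\<^sup>2
    = (1 - (norm \<alpha>)\<^sup>2) * ((norm a)\<^sup>2 - (norm x)\<^sup>2)"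
  unfolding norm_quat_power2 by (simp add: power2_eq_square algebra_simps)

text \<open>The inequalities follow from the identity. The nonvanishing holds because the subtracted
  term is strictly shorter than the nonzero dominant one.\<close>

lemma schur_step:
  fixes a x \<alpha> :: quat
  assumes "norm \<alpha> < 1"
  shows "norm x \<le> norm a \<Longrightarrow> norm (x - a * \<alpha>) \<le> norm (a - x * qcnj \<alpha>)"
    and "norm a \<le> norm x \<Longrightarrow> norm (a - x * qcnj \<alpha>) \<le> norm (x - a * \<alpha>)"
    and "norm x \<le> norm a \<Longrightarrow> a \<noteq> 0 \<Longrightarrow> a - x * qcnj \<alpha> \<noteq> 0"
    and "norm a \<le> norm x \<Longrightarrow> x \<noteq> 0 \<Longrightarrow> x - a * \<alpha> \<noteq> 0"
proof -
  have pos: "1 - (norm \<alpha>)\<^sup>2 > 0"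
    using assms by (simp add: power_less_one_iff)
  have strict: "u \<noteq> v * \<beta>" if "norm v \<le> norm u" "u \<noteq> 0" "norm \<beta> < 1" for u v \<beta> :: quat
  proof
    assume u: "u = v * \<beta>"
    have "norm v * norm \<beta> \<le> norm u * norm \<beta>"
      using that by (simp add: mult_right_mono)
    also have "\<dots> < norm u * 1"
      using that by (intro mult_strict_left_mono) auto
    finally show False using u by (simp add: norm_mult)
  qed
  show "norm (x - a * \<alpha>) \<le> norm (a - x * qcnj \<alpha>)" if "norm x \<le> norm a"
  proof (rule power2_le_imp_le)
    have "0 \<le> (1 - (norm \<alpha>)\<^sup>2) * ((norm a)\<^sup>2 - (norm x)\<^sup>2)"
      using pos that by (intro mult_nonneg_nonneg) (simp_all add: power_mono)
    thus "(norm (x - a * \<alpha>))\<^sup>2 \<le> (norm (a - x * qcnj \<alpha>))\<^sup>2"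
      using schur_step_identity[of a x \<alpha>] by linarith
  qed simp
  show "norm (a - x * qcnj \<alpha>) \<le> norm (x - a * \<alpha>)" if "norm a \<le> norm x"
  proof (rule power2_le_imp_le)
    have "(1 - (norm \<alpha>)\<^sup>2) * ((norm a)\<^sup>2 - (norm x)\<^sup>2) \<le> 0"
      using pos that by (intro mult_nonneg_nonpos) (simp_all add: power_mono)
    thus "(norm (a - x * qcnj \<alpha>))\<^sup>2 \<le> (norm (x - a * \<alpha>))\<^sup>2"
      using schur_step_identity[of a x \<alpha>] by linarith
  qed simp
  show "norm x \<le> norm a \<Longrightarrow> a \<noteq> 0 \<Longrightarrow> a - x * qcnj \<alpha> \<noteq> 0"
    using strict[of x a "qcnj \<alpha>"] assms by auto
  show "norm a \<le> norm x \<Longrightarrow> x \<noteq> 0 \<Longrightarrow> x - a * \<alpha> \<noteq> 0"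
    using strict[of a x \<alpha>] assms by auto
qed

context nontrivial_pd_pair
begin

lemma evalL_Suc:
  "evalL (\<Phi> (Suc n)) q = q * evalL (\<Phi> n) q - evalL (reflect_poly (\<Phi>' n)) q * verblunsky n"
  "evalL (reflect_poly (\<Phi>' (Suc n))) q
    = evalL (reflect_poly (\<Phi>' n)) q - q * evalL (\<Phi> n) q * qcnj (verblunsky n)"
  by (simp_all add: monic_orthogonalR_Suc reflect_monic_orthogonalR_Suc evalL_diff
      evalL_mult_scalar_right evalL_pCons_0)

lemma evalL_0: "evalL (\<Phi> 0) q = 1" "evalL (reflect_poly (\<Phi>' 0)) q = 1"
  by (simp_all add: monic_orthogonalR_0 evalL_def)

text \<open>Both conjuncts are carried through one induction, since the nonvanishing at n + 1 needs
  the inequality at n. Weak inequalities let the argument include the unit sphere.\<close>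

lemma star_dominates_inside:
  assumes "norm q \<le> 1"
  shows "norm (evalL (\<Phi> n) q) \<le> norm (evalL (reflect_poly (\<Phi>' n)) q)
    \<and> evalL (reflect_poly (\<Phi>' n)) q \<noteq> 0"
proof (induction n)
  case 0
  show ?case by (simp add: evalL_0)
next
  case (Suc n)
  have "norm (q * evalL (\<Phi> n) q) \<le> 1 * norm (evalL (\<Phi> n) q)"
    unfolding norm_mult using assms by (intro mult_right_mono) auto
  hence "norm (q * evalL (\<Phi> n) q) \<le> norm (evalL (reflect_poly (\<Phi>' n)) q)"
    using Suc by linarith
  thus ?case
    unfolding evalL_Suc using Suc by (intro conjI schur_step(1,3) verblunsky_less_1) auto
qed

lemma star_dominated_outside:
  assumes "norm q \<ge> 1"
  shows "norm (evalL (reflect_poly (\<Phi>' n)) q) \<le> norm (evalL (\<Phi> n) q) \<and> evalL (\<Phi> n) q \<noteq> 0"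
proof (induction n)
  case 0
  show ?case by (simp add: evalL_0)
next
  case (Suc n)
  have "1 * norm (evalL (\<Phi> n) q) \<le> norm (q * evalL (\<Phi> n) q)"
    unfolding norm_mult using assms by (intro mult_right_mono) auto
  hence "norm (evalL (reflect_poly (\<Phi>' n)) q) \<le> norm (q * evalL (\<Phi> n) q)"
    using Suc by linarith
  moreover have "q * evalL (\<Phi> n) q \<noteq> 0"
    using Suc assms by auto
  ultimately show ?case
    unfolding evalL_Suc by (intro conjI schur_step(2,4) verblunsky_less_1)
qed

lemma zerosL_monic_subset: "zerosL (\<Phi> n) \<subseteq> ball 0 1"
proof
  fix q assume "q \<in> zerosL (\<Phi> n)"
  thus "q \<in> ball 0 1"
    using star_dominated_outside[of q n] by (cases "norm q < 1") (auto simp: zerosL_def)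
qed

lemma zerosL_star_subset: "zerosL (reflect_poly (\<Phi>' n)) \<subseteq> UNIV - closure (ball 0 1)"
proof
  fix q assume "q \<in> zerosL (reflect_poly (\<Phi>' n))"
  thus "q \<in> UNIV - closure (ball 0 1)"
    using star_dominates_inside[of q n] by (cases "norm q \<le> 1") (auto simp: zerosL_def)
qed

end

section \<open>From right- to left-orthonormal polynomials by conjugation\<close>

text \<open>Conjugating each term reverses its factors, and Hermitian symmetry replaces the
  conjugate of \<open>c\<close> by the reflected sequence.\<close>

lemma innerL_eq_innerR:
  assumes "positive_definite_seq c"
  shows "innerL c \<phi> \<psi> = qcnj (innerR (\<lambda>i. c (- i)) (map_poly qcnj \<phi>) (map_poly qcnj \<psi>))"
  by (simp add: innerL_def innerR_def coeff_map_poly mult.assoc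
      positive_definite_seq_hermitian[OF assms] del: minus_diff_eq)

lemma map_poly_qcnj_simps:
  "map_poly qcnj (\<phi> - \<psi>) = map_poly qcnj \<phi> - map_poly qcnj \<psi>"
  "map_poly qcnj (monom 1 n) = monom 1 n"
  "map_poly qcnj (mult_scalar_right \<phi> a) = mult_scalar_left (qcnj a) (map_poly qcnj \<phi>)"
  "map_poly qcnj (sum f A) = (\<Sum>x\<in>A. map_poly qcnj (f x))"
  by (rule poly_eqI; simp add: coeff_map_poly coeff_sum)+

text \<open>The two Gram-Schmidt recursions correspond term by term; the normalising factors agree
  because they are real and depend only on a real part.\<close>

lemma orthonormal_polyL_eq:
  assumes "positive_definite_seq c"
  shows "orthonormal_polyL c n = map_poly qcnj (orthonormal_polyR (\<lambda>i. c (- i)) n)"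
proof (induction n rule: less_induct)
  case (less n)
  let ?c = "\<lambda>i. c (- i)"
  let ?\<phi> = "monom 1 n - (\<Sum>j<n. mult_scalar_left (innerL c (monom 1 n) (orthonormal_polyL c j))
                                  (orthonormal_polyL c j))"
  have \<phi>: "?\<phi> = map_poly qcnj (monic_orthogonalR ?c n)"
    by (simp add: monic_orthogonalR_def map_poly_qcnj_simps less innerL_eq_innerR[OF assms])
  show ?case
    apply (subst orthonormal_polyL.simps)
    unfolding Let_def \<phi>
    by (subst orthonormal_polyR_eq)
       (simp add: map_poly_qcnj_simps innerL_eq_innerR[OF assms] del: of_real_divide)
qed

lemma zerosR_eq: "zerosR \<phi> = qcnj ` zerosL (map_poly qcnj \<phi>)"
proof (intro equalityI subsetI)
  fix q assume "q \<in> zerosR \<phi>"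
  hence "qcnj q \<in> zerosL (map_poly qcnj \<phi>)"
    by (simp add: zerosR_def zerosL_def evalR_eq_evalL)
  thus "q \<in> qcnj ` zerosL (map_poly qcnj \<phi>)"
    by (intro image_eqI[of _ _ "qcnj q"]) auto
qed (auto simp: zerosR_def zerosL_def evalR_eq_evalL)

theorem theorem6p8:
  fixes c :: "int \<Rightarrow> quat" and n :: nat
  assumes "nontrivial_positive_definite_seq c"
  shows "zerosR (orthonormal_polyL c n) \<subseteq> ball 0 1 \<and>
         zerosL (orthonormal_polyR c n) \<subseteq> ball 0 1 \<and>
         zerosL (reverse_qpoly (orthonormal_polyL c n)) \<subseteq> UNIV - closure (ball 0 1) \<and>
         zerosR (reverse_qpoly (orthonormal_polyR c n)) \<subseteq> UNIV - closure (ball 0 1)"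
proof -
  interpret nontrivial_pd_pair c by (rule nontrivial_pd_pair) fact
  interpret r: nontrivial_pd_pair "\<lambda>i. c (- i)"
    by (rule nontrivial_pd_pair) (rule rfl.nontriv)
  have pd: "positive_definite_seq c"
    using assms by (simp add: nontrivial_positive_definite_seq_def)
  have rev: "map_poly qcnj (reverse_qpoly \<phi>) = reflect_poly \<phi>" for \<phi>
    by (rule poly_eqI) (simp add: reverse_qpoly_def coeff_reflect_poly coeff_map_poly)
  \<comment> \<open>By \<open>zerosR_eq\<close> these are conjugates of zeros of a right-orthonormal
    polynomial of the reflected sequence, and conjugation preserves the norm.\<close>
  have "zerosR (orthonormal_polyL c n) \<subseteq> ball 0 1"
    using r.zerosL_monic_subset[of n]
    by (auto simp: zerosR_eq orthonormal_polyL_eq[OF pd] rfl.zerosL_orthonormal_polyR)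
  moreover have "zerosL (orthonormal_polyR c n) \<subseteq> ball 0 1"
    using zerosL_monic_subset by (simp add: zerosL_orthonormal_polyR)
  moreover have "zerosL (reverse_qpoly (orthonormal_polyL c n)) \<subseteq> UNIV - closure (ball 0 1)"
    using zerosL_star_subset[of n]
    by (simp add: orthonormal_polyL_eq[OF pd] rfl.zerosL_reflect_orthonormal_polyR)
  \<comment> \<open>Reflecting twice gives back \<open>c\<close>, so \<open>\<Phi>'\<close> in the
    interpretation \<open>r\<close> is \<open>\<Phi>\<close>.\<close>
  moreover have "zerosR (reverse_qpoly (orthonormal_polyR c n)) \<subseteq> UNIV - closure (ball 0 1)"
    using r.zerosL_star_subset[of n]
    by (auto simp: zerosR_eq rev zerosL_reflect_orthonormal_polyR)
  ultimately show ?thesis by blast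
qed

end
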